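(* Let $\mathbf{T}=(T_1,\dots,T_n)$ be a commuting $n$-tuple of bounded linear operators on a Hilbert space $\mathcal{H}$, and let $(X,\mathbf{U})$ be a unitary asymptote of $\mathbf{T}$ with $X\ne0$. For every $\mathcal{N}\in\operatorname{Hlat}\mathbf{U}$, we have $\mathcal{M}=X^{-1}\mathcal{N}\in\operatorname{Hlat}\mathbf{T}$; in particular, $\mathcal{H}_0(\mathbf{T})=X^{-1}(\{0\})\in\operatorname{Hlat}\mathbf{T}$.
   Context: Let $n\in\mathbb{N}$. Hilbert spaces are complex; $\mathcal{H}$ is separable; operators and transformations are bounded and linear; subspaces are closed. For commuting $n$-tuples $\mathbf{T}=(T_1,\dots,T_n)$ on $\mathcal{H}$ and $\widetilde{\mathbf{T}}=(\widetilde T_1,\dots,\widetilde T_n)$ on $\widetilde{\mathcal{H}}$, the intertwining set $\mathcal{I}(\mathbf{T},\widetilde{\mathbf{T}})$ consists of all bounded linear $X\colon\mathcal{H}\to\widetilde{\mathcal{H}}$ with $XT_i=\widetilde T_iX$ for $1\le i\le n$; the commutant is $\{\mathbf{T}\}'=\mathcal{I}(\mathbf{T},\mathbf{T})$. A unitary intertwining pair of $\mathbf{T}$ is a pair $(X,\mathbf{U})$, where $\mathbf{U}=(U_1,\dots,U_n)$ is a commuting $n$-tuple of unitary operators on some Hilbert space $\mathcal{K}$ and $X\in\mathcal{I}(\mathbf{T},\mathbf{U})$. It is a unitary asymptote of $\mathbf{T}$ if for every unitary intertwining pair $(X',\mathbf{U}')$ of $\mathbf{T}$ there exists a unique $Y'\in\mathcal{I}(\mathbf{U},\mathbf{U}')$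 with $X'=Y'X$. The hyperinvariant subspace lattice $\operatorname{Hlat}\mathbf{T}$ consists of those subspaces $\mathcal{M}$ of $\mathcal{H}$ with $C\mathcal{M}\subset\mathcal{M}$ for all $C\in\{\mathbf{T}\}'$; $\operatorname{Hlat}\mathbf{U}$ is defined analogously. $X^{-1}\mathcal{N}$ denotes the preimage $\{h\in\mathcal{H}:Xh\in\mathcal{N}\}$. The annihilating subspace $\mathcal{H}_0(\mathbf{T})$ is $\ker X$, which is the same for every unitary asymptote of $\mathbf{T}$. *)

theory Defs
  imports "HOL-Analysis.Analysis" "HOL-Algebra.Module"
begin

section \<open>Complex Hilbert spaces with explicit carriers\<close>

text \<open>
  A unitary asymptote is defined by quantifying over Hilbert spaces, so Hilbert spaces have to be
  values rather than types. They are modules over the field of complex numbers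
  in the sense of HOL-Algebra, with an inner product that is linear in its first argument.
  (The fields \<open>mult\<close> and \<open>one\<close> that modules inherit from rings carry no meaning.)
\<close>

definition complex_field :: "complex ring"
  where "complex_field = \<lparr>carrier = UNIV, mult = (*), one = 1, zero = 0, add = (+)\<rparr>"

record 'a hilbert = "(complex, 'a) module" +
  cinner :: "'a \<Rightarrow> 'a \<Rightarrow> complex"

definition hnorm :: "'a hilbert \<Rightarrow> 'a \<Rightarrow> real"
  where "hnorm H x = sqrt (Re (cinner H x x))"

text \<open>The value \<open>0\<close> off the carrier is there because \<^locale>\<open>Metric_space\<close> asks for a nonnegative
  symmetric function on the whole type.\<close>

definition hdist :: "'a hilbert \<Rightarrow> 'a \<Rightarrow> 'a \<Rightarrow> real"
  where "hdist H x y =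
    (if x \<in> carrier H \<and> y \<in> carrier H then hnorm H (x \<ominus>\<^bsub>H\<^esub> y) else 0)"

definition htopology :: "'a hilbert \<Rightarrow> 'a topology"
  where "htopology H = Metric_space.mtopology (carrier H) (hdist H)"

locale inner_product_space = module complex_field H for H :: "'a hilbert" (structure) +
  assumes cinner_add_left:
      "\<lbrakk>x \<in> carrier H; y \<in> carrier H; z \<in> carrier H\<rbrakk>
        \<Longrightarrow> cinner H (x \<oplus> y) z = cinner H x z + cinner H y z"
    and cinner_smult_left:
      "\<lbrakk>x \<in> carrier H; y \<in> carrier H\<rbrakk> \<Longrightarrow> cinner H (a \<odot> x) y = a * cinner H x y"
    and cinner_commute:
      "\<lbrakk>x \<in> carrier H; y \<in> carrier H\<rbrakk> \<Longrightarrow> cinner H x y = cnj (cinner H y x)"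
    and cinner_nonneg: "x \<in> carrier H \<Longrightarrow> 0 \<le> Re (cinner H x x)"
    and cinner_eq_zero: "\<lbrakk>x \<in> carrier H; cinner H x x = 0\<rbrakk> \<Longrightarrow> x = \<zero>"

locale hilbert_space = inner_product_space +
  assumes complete: "Metric_space.mcomplete (carrier H) (hdist H)"

definition closed_subspace :: "'a hilbert \<Rightarrow> 'a set \<Rightarrow> bool"
  where "closed_subspace H M \<longleftrightarrow> submodule M complex_field H \<and> closedin (htopology H) M"


section \<open>Operators, commuting tuples and intertwiners\<close>

text \<open>
  Operators are extensional functions on the carrier, so equality of operators is equality in HOL
  and their product is \<open>compose\<close>. An \<open>n\<close>-tuple is a function of which only the values at
  \<open>1, \<dots>, n\<close> are used.
\<close>

definition bounded_operators :: "'a hilbert \<Rightarrow> 'b hilbert \<Rightarrow> ('a \<Rightarrow> 'b) set"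
  where "bounded_operators H K =
    {X \<in> carrier H \<rightarrow>\<^sub>E carrier K.
      (\<forall>x\<in>carrier H. \<forall>y\<in>carrier H. X (x \<oplus>\<^bsub>H\<^esub> y) = X x \<oplus>\<^bsub>K\<^esub> X y) \<and>
      (\<forall>a. \<forall>x\<in>carrier H. X (a \<odot>\<^bsub>H\<^esub> x) = a \<odot>\<^bsub>K\<^esub> X x) \<and>
      (\<exists>B. \<forall>x\<in>carrier H. hnorm K (X x) \<le> B * hnorm H x)}"

definition unitary_operators :: "'a hilbert \<Rightarrow> ('a \<Rightarrow> 'a) set"
  where "unitary_operators H =
    {U \<in> bounded_operators H H. U ` carrier H = carrier H \<and>
      (\<forall>x\<in>carrier H. \<forall>y\<in>carrier H. cinner H (U x) (U y) = cinner H x y)}"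

definition commuting_tuple :: "nat \<Rightarrow> 'a hilbert \<Rightarrow> (nat \<Rightarrow> 'a \<Rightarrow> 'a) \<Rightarrow> bool"
  where "commuting_tuple n H T \<longleftrightarrow>
    (\<forall>i\<in>{1..n}. T i \<in> bounded_operators H H) \<and>
    (\<forall>i\<in>{1..n}. \<forall>j\<in>{1..n}. compose (carrier H) (T i) (T j) = compose (carrier H) (T j) (T i))"

definition intertwiners ::
    "nat \<Rightarrow> 'a hilbert \<Rightarrow> (nat \<Rightarrow> 'a \<Rightarrow> 'a) \<Rightarrow> 'b hilbert \<Rightarrow> (nat \<Rightarrow> 'b \<Rightarrow> 'b) \<Rightarrow> ('a \<Rightarrow> 'b) set"
  where "intertwiners n H T K S =
    {X \<in> bounded_operators H K.
      \<forall>i\<in>{1..n}. compose (carrier H) X (T i) = compose (carrier H) (S i) X}"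

definition commutant :: "nat \<Rightarrow> 'a hilbert \<Rightarrow> (nat \<Rightarrow> 'a \<Rightarrow> 'a) \<Rightarrow> ('a \<Rightarrow> 'a) set"
  where "commutant n H T = intertwiners n H T H T"

definition Hlat :: "nat \<Rightarrow> 'a hilbert \<Rightarrow> (nat \<Rightarrow> 'a \<Rightarrow> 'a) \<Rightarrow> 'a set set"
  where "Hlat n H T = {M. closed_subspace H M \<and> (\<forall>C\<in>commutant n H T. C ` M \<subseteq> M)}"


section \<open>Unitary asymptotes\<close>

definition unitary_intertwining_pair ::
    "nat \<Rightarrow> 'a hilbert \<Rightarrow> (nat \<Rightarrow> 'a \<Rightarrow> 'a) \<Rightarrow> 'k hilbert \<Rightarrow> ('a \<Rightarrow> 'k) \<Rightarrow> (nat \<Rightarrow> 'k \<Rightarrow> 'k) \<Rightarrow> bool"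
  where "unitary_intertwining_pair n H T K X U \<longleftrightarrow>
    hilbert_space K \<and> commuting_tuple n K U \<and> (\<forall>i\<in>{1..n}. U i \<in> unitary_operators K) \<and>
    X \<in> intertwiners n H T K U"

text \<open>
  The type \<open>'k\<close> plays the role of a universe: the universal property is tested on all Hilbert
  spaces \<open>K'\<close> whose carrier is a set of elements of \<open>'k\<close>. For separable \<open>H\<close> and nonzero \<open>K\<close>
  this amounts to testing on all Hilbert spaces whatsoever. First, \<open>'k\<close> contains the nonzero complex
  vector space \<open>K\<close>, so it has at least the cardinality of the continuum, and every separable Hilbert
  space has an isomorphic copy with carrier in \<open>'k\<close>. Second, separable \<open>K'\<close> suffice: \<open>X'\<close> maps
  into the separable subspace of \<open>K'\<close> reducing \<open>U'\<close> that the range of \<open>X'\<close> generates, which gives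
  existence, and two different factorizations remain different after projecting to the separable
  reducing subspace generated by a single vector at which they differ.
\<close>

definition unitary_asymptote ::
    "nat \<Rightarrow> 'a hilbert \<Rightarrow> (nat \<Rightarrow> 'a \<Rightarrow> 'a) \<Rightarrow> 'k hilbert \<Rightarrow> ('a \<Rightarrow> 'k) \<Rightarrow> (nat \<Rightarrow> 'k \<Rightarrow> 'k) \<Rightarrow> bool"
  where "unitary_asymptote n H T K X U \<longleftrightarrow>
    unitary_intertwining_pair n H T K X U \<and>
    (\<forall>(K' :: 'k hilbert) X' U'. unitary_intertwining_pair n H T K' X' U' \<longrightarrow>
      (\<exists>!Y'. Y' \<in> intertwiners n K U K' U' \<and> X' = compose (carrier H) Y' X))"

text \<open>
  The common kernel of all unitary asymptotes (see \<open>annihilating_subspace_eq\<close> below).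
\<close>

definition annihilating_subspace ::
    "'k itself \<Rightarrow> nat \<Rightarrow> 'a hilbert \<Rightarrow> (nat \<Rightarrow> 'a \<Rightarrow> 'a) \<Rightarrow> 'a set"
  where "annihilating_subspace _ n H T =
    (THE M. \<exists>(K :: 'k hilbert) X U.
      unitary_asymptote n H T K X U \<and> M = X -` {\<zero>\<^bsub>K\<^esub>} \<inter> carrier H)"

lemma bounded_operators_zero:
  assumes "hilbert_space H" "hilbert_space K" "X \<in> bounded_operators H K"
  shows "X \<zero>\<^bsub>H\<^esub> = \<zero>\<^bsub>K\<^esub>"
proof -
  interpret H: hilbert_space H by fact
  interpret K: hilbert_space K by fact
  have X: "X \<zero>\<^bsub>H\<^esub> \<in> carrier K"
    using assms(3) by (auto simp: bounded_operators_def)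
  have "X (0 \<odot>\<^bsub>H\<^esub> \<zero>\<^bsub>H\<^esub>) = 0 \<odot>\<^bsub>K\<^esub> X \<zero>\<^bsub>H\<^esub>"
    using assms(3) by (auto simp: bounded_operators_def)
  then show ?thesis
    using H.smult_l_null[of "\<zero>\<^bsub>H\<^esub>"] K.smult_l_null[OF X] by (simp add: complex_field_def)
qed

lemma unitary_asymptote_kernel_subset:
  fixes K K' :: "'k hilbert"
  assumes "unitary_asymptote n H T K X U" "unitary_asymptote n H T K' X' U'"
  shows "X -` {\<zero>\<^bsub>K\<^esub>} \<inter> carrier H \<subseteq> X' -` {\<zero>\<^bsub>K'\<^esub>} \<inter> carrier H"
proof -
  have pair: "unitary_intertwining_pair n H T K X U" "unitary_intertwining_pair n H T K' X' U'"
    using assms by (simp_all add: unitary_asymptote_def)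
  have "\<exists>!Y. Y \<in> intertwiners n K U K' U' \<and> X' = compose (carrier H) Y X"
    using assms(1)[unfolded unitary_asymptote_def, THEN conjunct2, rule_format, OF pair(2)] .
  then obtain Y where Y: "Y \<in> intertwiners n K U K' U'" "X' = compose (carrier H) Y X"
    by (elim ex1E conjE)
  have "Y \<zero>\<^bsub>K\<^esub> = \<zero>\<^bsub>K'\<^esub>"
  proof (rule bounded_operators_zero)
    show "hilbert_space K" "hilbert_space K'"
      using pair by (simp_all add: unitary_intertwining_pair_def)
    show "Y \<in> bounded_operators K K'"
      using Y(1) by (simp add: intertwiners_def)
  qed
  then show ?thesis
    by (auto simp: Y(2) compose_eq)
qed

lemma annihilating_subspace_eq:
  fixes K :: "'k hilbert"
  assumes "unitary_asymptote n H T K X U"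
  shows "annihilating_subspace TYPE('k) n H T = X -` {\<zero>\<^bsub>K\<^esub>} \<inter> carrier H"
  unfolding annihilating_subspace_def
proof (rule the_equality)
  show "\<exists>(K' :: 'k hilbert) X' U'. unitary_asymptote n H T K' X' U' \<and>
      X -` {\<zero>\<^bsub>K\<^esub>} \<inter> carrier H = X' -` {\<zero>\<^bsub>K'\<^esub>} \<inter> carrier H"
    by (intro exI conjI) (rule assms, rule refl)
next
  fix M
  assume "\<exists>(K' :: 'k hilbert) X' U'. unitary_asymptote n H T K' X' U' \<and>
      M = X' -` {\<zero>\<^bsub>K'\<^esub>} \<inter> carrier H"
  then obtain K' :: "'k hilbert" and X' U' where
    *: "unitary_asymptote n H T K' X' U'" and M: "M = X' -` {\<zero>\<^bsub>K'\<^esub>} \<inter> carrier H"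
    by (elim exE conjE)
  show "M = X -` {\<zero>\<^bsub>K\<^esub>} \<inter> carrier H"
    unfolding M
    by (rule subset_antisym unitary_asymptote_kernel_subset[OF * assms]
        unitary_asymptote_kernel_subset[OF assms *])+
qed

end

(* If C commutes with T, then (X C, U) is again a unitary intertwining pair of T, so the universal
   property of (X, U) yields Y in the commutant of U with X C = Y X. Hence X h \<in> N implies
   X (C h) = Y (X h) \<in> N for every hyperinvariant N. *)
theory Submission
  imports Defs
begin

section \<open>Inner product spaces: Cauchy-Schwarz, the norm and the induced metric\<close>

context inner_product_space
begin

lemma complex_field_simps [simp]:
  "carrier complex_field = UNIV" "\<zero>\<^bsub>complex_field\<^esub> = 0" "\<one>\<^bsub>complex_field\<^esub> = 1"
  "a \<oplus>\<^bsub>complex_field\<^esub> b = a + b" "a \<otimes>\<^bsub>complex_field\<^esub> b = a * b"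
  by (simp_all add: complex_field_def)

lemma smult_closed_complex [simp]: "x \<in> carrier H \<Longrightarrow> a \<odot> x \<in> carrier H"
  using smult_closed[of a x] by simp

text \<open>Reduces additive inverses and differences to scalar multiplication, so that homogeneity
  alone settles the symmetry of the metric, the images of differences under operators, and closure
  under negation.\<close>

lemma minus_one_smult:
  assumes "x \<in> carrier H"
  shows "(-1) \<odot> x = \<ominus> x"
proof -
  have "(-1) \<odot> x \<oplus> x = (-1 + 1) \<odot> x"
    using assms smult_l_distr[of "-1" 1 x] smult_one[OF assms] by simp
  also have "\<dots> = \<zero>"
    using assms smult_l_null[of x] by simp
  finally show ?thesis
    using assms by (simp add: M.minus_equality)
qed

lemma cinner_add_right:
  assumes "x \<in> carrier H" "y \<in> carrier H" "z \<in> carrier H"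
  shows "cinner H z (x \<oplus> y) = cinner H z x + cinner H z y"
  using assms cinner_commute[of z "x \<oplus> y"] cinner_commute[of z x] cinner_commute[of z y]
  by (simp add: cinner_add_left)

lemma cinner_smult_right:
  assumes "x \<in> carrier H" "y \<in> carrier H"
  shows "cinner H y (a \<odot> x) = cnj a * cinner H y x"
  using assms cinner_commute[of y "a \<odot> x"] cinner_commute[of y x]
  by (simp add: cinner_smult_left)

text \<open>Conjugate symmetry makes the number equal to its own conjugate. Since
  \<open>hnorm\<close> sees only the real part, this is what links it to the definiteness axiom,
  which concerns the complex value.\<close>

lemma Im_cinner_self:
  assumes "x \<in> carrier H"
  shows "Im (cinner H x x) = 0"
  using arg_cong[where f = Im, OF cinner_commute[OF assms assms]] by simp

lemma hnorm_nonneg: "x \<in> carrier H \<Longrightarrow> 0 \<le> hnorm H x"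
  by (simp add: hnorm_def cinner_nonneg)

lemma hnorm_square: "x \<in> carrier H \<Longrightarrow> (hnorm H x)\<^sup>2 = Re (cinner H x x)"
  by (simp add: hnorm_def cinner_nonneg)

lemma hnorm_smult:
  assumes "x \<in> carrier H"
  shows "hnorm H (a \<odot> x) = cmod a * hnorm H x"
proof -
  have "cinner H (a \<odot> x) (a \<odot> x) = (a * cnj a) * cinner H x x"
    using assms by (simp add: cinner_smult_left cinner_smult_right)
  \<comment> \<open>Writing \<open>a * cnj a\<close> as a real scalar lets \<open>Re\<close> pass
    through the product.\<close>
  then have "cinner H (a \<odot> x) (a \<odot> x) = of_real ((cmod a)\<^sup>2) * cinner H x x"
    by (simp only: complex_norm_square)
  then have "Re (cinner H (a \<odot> x) (a \<odot> x)) = (cmod a)\<^sup>2 * Re (cinner H x x)"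
    by simp
  then show ?thesis
    by (simp add: hnorm_def real_sqrt_mult)
qed

lemma hnorm_eq_zero_iff:
  assumes "x \<in> carrier H"
  shows "hnorm H x = 0 \<longleftrightarrow> x = \<zero>"
proof
  assume "hnorm H x = 0"
  then have "Re (cinner H x x) = 0"
    by (simp add: hnorm_def)
  then have "cinner H x x = 0"
    using Im_cinner_self[OF assms] by (simp add: complex_eq_iff)
  then show "x = \<zero>"
    using assms cinner_eq_zero by blast
next
  assume "x = \<zero>"
  then show "hnorm H x = 0"
    using assms hnorm_smult[of x 0] smult_l_null[of x] by simp
qed

text \<open>Positivity is applied to a vector orthogonal to \<open>y\<close>. It yields the
  inequality multiplied by \<open>b\<close>, the squared norm of \<open>y\<close>; the factor
  cancels if \<open>b\<close> is positive, and \<open>y\<close> vanishes otherwise.\<close>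

lemma Cauchy_Schwarz:
  assumes x: "x \<in> carrier H" and y: "y \<in> carrier H"
  shows "cmod (cinner H x y) \<le> hnorm H x * hnorm H y"
proof -
  define a where "a = Re (cinner H x x)"
  define b where "b = Re (cinner H y y)"
  define c where "c = cinner H x y"
  have a: "cinner H x x = of_real a" and b: "cinner H y y = of_real b"
    using x y by (simp_all add: a_def b_def complex_eq_iff Im_cinner_self)
  have c: "cinner H y x = cnj c"
    unfolding c_def by (rule cinner_commute[OF y x])
  have b0: "0 \<le> b"
    using y by (simp add: b_def cinner_nonneg)
  \<comment> \<open>The component of \<open>x\<close> orthogonal to \<open>y\<close>, multiplied by
    \<open>b\<close> to avoid a division that would fail for \<open>b = 0\<close>.\<close>
  let ?z = "of_real b \<odot> x \<oplus> (- c) \<odot> y"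
  have "cinner H ?z ?z = of_real b * (of_real a * of_real b - c * cnj c)"
    using x y
    by (simp add: cinner_add_left cinner_add_right cinner_smult_left cinner_smult_right
        a b c c_def[symmetric] algebra_simps)
  also have "\<dots> = of_real (b * (a * b - (cmod c)\<^sup>2))"
    by (simp only: complex_norm_square of_real_mult of_real_diff)
  finally have "0 \<le> b * (a * b - (cmod c)\<^sup>2)"
    using x y cinner_nonneg[of ?z] by simp
  \<comment> \<open>For \<open>b = 0\<close> the inequality just obtained is empty; definiteness
    gives \<open>y\<close> zero, and writing \<open>y\<close> as \<open>0\<close> times itself makes
    the inner product vanish.\<close>
  moreover have "c = 0" if "b = 0"
  proof -
    have "y = \<zero>"
      using that b y cinner_eq_zero by simp
    then have "y = 0 \<odot> y"
      using y smult_l_null[of y] by simp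
    then show ?thesis
      using x y cinner_smult_right[of y x 0] by (simp add: c_def)
  qed
  ultimately have "(cmod c)\<^sup>2 \<le> a * b"
    using b0 by (cases "b = 0") (simp_all add: zero_le_mult_iff)
  then show ?thesis
    by (simp add: hnorm_def a_def b_def c_def real_le_rsqrt flip: real_sqrt_mult)
qed

lemma hnorm_triangle:
  assumes x: "x \<in> carrier H" and y: "y \<in> carrier H"
  shows "hnorm H (x \<oplus> y) \<le> hnorm H x + hnorm H y"
proof (rule power2_le_imp_le)
  \<comment> \<open>The two cross terms are conjugate, so together they contribute twice a real
    part.\<close>
  have "Re (cinner H y x) = Re (cinner H x y)"
    using cinner_commute[OF y x] by simp
  then have "(hnorm H (x \<oplus> y))\<^sup>2 = (hnorm H x)\<^sup>2 + 2 * Re (cinner H x y) + (hnorm H y)\<^sup>2"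
    using x y by (simp add: hnorm_square cinner_add_left cinner_add_right)
  also have "Re (cinner H x y) \<le> hnorm H x * hnorm H y"
    using Cauchy_Schwarz[OF x y] complex_Re_le_cmod[of "cinner H x y"] by linarith
  finally show "(hnorm H (x \<oplus> y))\<^sup>2 \<le> (hnorm H x + hnorm H y)\<^sup>2"
    by (simp add: power2_sum algebra_simps)
  show "0 \<le> hnorm H x + hnorm H y"
    using x y by (simp add: hnorm_nonneg)
qed

text \<open>Gives access to the general theory of metric topologies for
  \<open>htopology\<close>.\<close>

lemma Metric_space_hdist: "Metric_space (carrier H) (hdist H)"
proof
  show "0 \<le> hdist H x y" for x y
    by (simp add: hdist_def hnorm_nonneg)
next
  fix x y
  show "hdist H x y = hdist H y x"
  proof (cases "x \<in> carrier H \<and> y \<in> carrier H")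
    case True
    \<comment> \<open>The scalar \<open>-1\<close> has modulus one, so it leaves the norm
      unchanged.\<close>
    then have "x \<ominus> y = (-1) \<odot> (y \<ominus> x)"
      by (simp add: minus_one_smult M.minus_eq M.minus_add M.a_comm)
    then show ?thesis
      using True by (simp add: hdist_def hnorm_smult)
  qed (auto simp: hdist_def)
next
  fix x y assume *: "x \<in> carrier H" "y \<in> carrier H"
  then have "x \<ominus> y = \<zero> \<longleftrightarrow> x = y"
    by (metis M.add.inv_closed M.add.inv_inv M.minus_eq M.minus_equality M.r_neg)
  with * show "hdist H x y = 0 \<longleftrightarrow> x = y"
    by (simp add: hdist_def hnorm_eq_zero_iff)
next
  fix x y z assume *: "x \<in> carrier H" "y \<in> carrier H" "z \<in> carrier H"
  then have "x \<ominus> z = (x \<ominus> y) \<oplus> (y \<ominus> z)"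
    by (simp add: M.minus_eq M.a_assoc M.r_neg1)
  then show "hdist H x z \<le> hdist H x y + hdist H y z"
    using * by (simp add: hdist_def hnorm_triangle)
qed

lemma topspace_htopology: "topspace (htopology H) = carrier H"
  using Metric_space.topspace_mtopology[OF Metric_space_hdist] by (simp add: htopology_def)

text \<open>Points are closed because a metric topology is Hausdorff.\<close>

lemma closed_subspace_zero: "closed_subspace H {\<zero>}"
proof -
  have "submodule {\<zero>} complex_field H"
    using smult_r_null by (intro submoduleI) auto
  moreover have "Hausdorff_space (htopology H)"
    unfolding htopology_def by (rule Metric_space.Hausdorff_space_mtopology[OF Metric_space_hdist])
  then have "closedin (htopology H) {\<zero>}"
    by (simp add: closedin_Hausdorff_singleton topspace_htopology)
  ultimately show ?thesis
    by (simp add: closed_subspace_def)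
qed

end

section \<open>Bounded operators: composition, continuity and preimages of closed subspaces\<close>

lemma bounded_operators_closed:
  "\<lbrakk>X \<in> bounded_operators H K; x \<in> carrier H\<rbrakk> \<Longrightarrow> X x \<in> carrier K"
  by (auto simp: bounded_operators_def)

lemma bounded_operators_add:
  "\<lbrakk>X \<in> bounded_operators H K; x \<in> carrier H; y \<in> carrier H\<rbrakk>
    \<Longrightarrow> X (x \<oplus>\<^bsub>H\<^esub> y) = X x \<oplus>\<^bsub>K\<^esub> X y"
  by (simp add: bounded_operators_def)

lemma bounded_operators_smult:
  "\<lbrakk>X \<in> bounded_operators H K; x \<in> carrier H\<rbrakk> \<Longrightarrow> X (a \<odot>\<^bsub>H\<^esub> x) = a \<odot>\<^bsub>K\<^esub> X x"
  by (simp add: bounded_operators_def)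

lemma bounded_operators_diff:
  assumes "inner_product_space H" "inner_product_space K" "X \<in> bounded_operators H K"
    and "x \<in> carrier H" "y \<in> carrier H"
  shows "X (x \<ominus>\<^bsub>H\<^esub> y) = X x \<ominus>\<^bsub>K\<^esub> X y"
proof -
  interpret H: inner_product_space H by fact
  interpret K: inner_product_space K by fact
  have "x \<ominus>\<^bsub>H\<^esub> y = x \<oplus>\<^bsub>H\<^esub> (-1) \<odot>\<^bsub>H\<^esub> y" "X x \<ominus>\<^bsub>K\<^esub> X y = X x \<oplus>\<^bsub>K\<^esub> (-1) \<odot>\<^bsub>K\<^esub> X y"
    using assms by (simp_all add: a_minus_def H.minus_one_smult K.minus_one_smult
        bounded_operators_closed)
  then show ?thesis
    using assms by (simp add: bounded_operators_add bounded_operators_smult)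
qed

text \<open>Strict positivity allows division by the bound when choosing a \<delta>, and keeps
  inequalities intact under multiplication when bounds are chained.\<close>

lemma bounded_operators_pos_bound:
  assumes "inner_product_space H" "X \<in> bounded_operators H K"
  obtains B where "0 < B" "\<And>x. x \<in> carrier H \<Longrightarrow> hnorm K (X x) \<le> B * hnorm H x"
proof -
  interpret H: inner_product_space H by fact
  obtain B where B: "\<And>x. x \<in> carrier H \<Longrightarrow> hnorm K (X x) \<le> B * hnorm H x"
    using assms(2) unfolding bounded_operators_def by blast
  show thesis
  \<comment> \<open>The given \<open>B\<close> may be zero or negative; enlarging it is harmless
    since norms are nonnegative.\<close>
  proof (rule that[of "max B 1"])
    fix x assume x: "x \<in> carrier H"
    have "B * hnorm H x \<le> max B 1 * hnorm H x"
      by (rule mult_right_mono) (simp_all add: H.hnorm_nonneg x)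
    with B[OF x] show "hnorm K (X x) \<le> max B 1 * hnorm H x"
      by linarith
  qed simp
qed

lemma bounded_operators_compose:
  assumes "inner_product_space G" "inner_product_space H"
    and X: "X \<in> bounded_operators G H" and Y: "Y \<in> bounded_operators H K"
  shows "compose (carrier G) Y X \<in> bounded_operators G K"
proof -
  interpret G: inner_product_space G by fact
  obtain A where A: "0 < A" "\<And>x. x \<in> carrier G \<Longrightarrow> hnorm H (X x) \<le> A * hnorm G x"
    using bounded_operators_pos_bound[OF assms(1) X] by blast
  obtain B where B: "0 < B" "\<And>x. x \<in> carrier H \<Longrightarrow> hnorm K (Y x) \<le> B * hnorm H x"
    using bounded_operators_pos_bound[OF assms(2) Y] by blast
  have "hnorm K (Y (X x)) \<le> (B * A) * hnorm G x" if x: "x \<in> carrier G" for x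
  proof -
    have "hnorm K (Y (X x)) \<le> B * hnorm H (X x)"
      using B(2) bounded_operators_closed[OF X x] by simp
    also have "\<dots> \<le> B * (A * hnorm G x)"
      using A(2)[OF x] B(1) by simp
    finally show ?thesis
      by (simp add: mult.assoc)
  qed
  then show ?thesis
    using bounded_operators_closed[OF X] bounded_operators_closed[OF Y]
      bounded_operators_add[OF X] bounded_operators_add[OF Y]
      bounded_operators_smult[OF X] bounded_operators_smult[OF Y]
    by (auto simp: bounded_operators_def compose_eq compose_def)
qed

text \<open>By linearity the norm bound, applied to differences, is a Lipschitz condition with
  constant \<open>B\<close>; hence the choice of \<open>\<epsilon> / B\<close> for \<delta>.\<close>

lemma continuous_map_bounded_operator:
  assumes "inner_product_space H" "inner_product_space K" "X \<in> bounded_operators H K"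
  shows "continuous_map (htopology H) (htopology K) X"
proof -
  interpret H: inner_product_space H by fact
  interpret K: inner_product_space K by fact
  obtain B where B: "0 < B" "\<And>x. x \<in> carrier H \<Longrightarrow> hnorm K (X x) \<le> B * hnorm H x"
    using bounded_operators_pos_bound[OF assms(1,3)] by blast
  have "\<exists>\<delta>>0. \<forall>x. x \<in> carrier H \<and> hdist H a x < \<delta> \<longrightarrow> hdist K (X a) (X x) < \<epsilon>"
    if a: "a \<in> carrier H" and e: "\<epsilon> > 0" for a \<epsilon>
  proof (intro exI[of _ "\<epsilon> / B"] conjI allI impI)
    show "\<epsilon> / B > 0"
      using B e by simp
    fix x assume x: "x \<in> carrier H \<and> hdist H a x < \<epsilon> / B"
    then have "hdist K (X a) (X x) = hnorm K (X (a \<ominus>\<^bsub>H\<^esub> x))"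
      using a assms by (simp add: hdist_def bounded_operators_closed bounded_operators_diff)
    also have "\<dots> \<le> B * hdist H a x"
      using a x B(2) by (simp add: hdist_def)
    also have "\<dots> < \<epsilon>"
      using x B(1) by (simp add: field_simps)
    finally show "hdist K (X a) (X x) < \<epsilon>" .
  qed
  moreover have "X ` carrier H \<subseteq> carrier K"
    using bounded_operators_closed[OF assms(3)] by blast
  ultimately show ?thesis
    by (simp add: htopology_def K.Metric_space_hdist
        Metric_space.metric_continuous_map[OF H.Metric_space_hdist])
qed

text \<open>The algebraic conditions pull back by linearity, closedness by continuity.\<close>

lemma closed_subspace_vimage:
  assumes "hilbert_space H" "hilbert_space K" and X: "X \<in> bounded_operators H K"
    and N: "closed_subspace K N"
  shows "closed_subspace H (X -` N \<inter> carrier H)"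
proof -
  interpret H: hilbert_space H by fact
  interpret K: hilbert_space K by fact
  have sub: "submodule N complex_field K"
    using N by (simp add: closed_subspace_def)
  interpret N: submodule N complex_field K by fact
  have "submodule (X -` N \<inter> carrier H) complex_field H"
  proof (rule H.submoduleI)
    \<comment> \<open>A submodule is a subgroup of the additive monoid, so \<open>one_closed\<close>
      speaks of the zero vector.\<close>
    show "\<zero>\<^bsub>H\<^esub> \<in> X -` N \<inter> carrier H"
      using bounded_operators_zero[OF assms(1,2) X] N.one_closed by simp
    show smult: "a \<odot>\<^bsub>H\<^esub> x \<in> X -` N \<inter> carrier H" if "x \<in> X -` N \<inter> carrier H" for a x
      using that N.smult_closed[of a] by (simp add: bounded_operators_smult[OF X])
    then show "\<ominus>\<^bsub>H\<^esub> x \<in> X -` N \<inter> carrier H" if "x \<in> X -` N \<inter> carrier H" for x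
      using that smult[of x "-1"] by (simp add: H.minus_one_smult)
    show "x \<oplus>\<^bsub>H\<^esub> y \<in> X -` N \<inter> carrier H"
      if "x \<in> X -` N \<inter> carrier H" "y \<in> X -` N \<inter> carrier H" for x y
      using that K.submoduleE(5)[OF sub] by (simp add: bounded_operators_add[OF X])
  qed simp
  moreover have "closedin (htopology H) {x \<in> topspace (htopology H). X x \<in> N}"
    using N continuous_map_bounded_operator[OF _ _ X]
      H.inner_product_space_axioms K.inner_product_space_axioms
    by (intro closedin_continuous_map_preimage) (auto simp: closed_subspace_def)
  moreover have "{x \<in> topspace (htopology H). X x \<in> N} = X -` N \<inter> carrier H"
    by (auto simp: H.topspace_htopology)
  ultimately show ?thesis
    by (simp add: closed_subspace_def)
qed

section \<open>Intertwiners and hyperinvariant subspaces\<close>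

text \<open>Moving \<open>T i\<close> to the left past \<open>C\<close> and then through
  \<open>X\<close> gives \<open>X C (T i) = X (T i) C = (U i) X C\<close>.\<close>

lemma intertwiners_compose_commutant:
  assumes "hilbert_space H"
    and T: "\<And>i. i \<in> {1..n} \<Longrightarrow> T i \<in> bounded_operators H H"
    and X: "X \<in> intertwiners n H T K U" and C: "C \<in> commutant n H T"
  shows "compose (carrier H) X C \<in> intertwiners n H T K U"
proof -
  interpret H: hilbert_space H by fact
  have Xb: "X \<in> bounded_operators H K" and Cb: "C \<in> bounded_operators H H"
    using X C by (simp_all add: intertwiners_def commutant_def)
  have "X (C (T i x)) = U i (X (C x))" if i: "i \<in> {1..n}" and x: "x \<in> carrier H" for i x
  proof -
    have "compose (carrier H) C (T i) x = compose (carrier H) (T i) C x"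
      using C i by (simp add: intertwiners_def commutant_def)
    \<comment> \<open>The intertwining relation is used at \<open>C x\<close> rather than at
      \<open>x\<close>; this point lies in the carrier, where \<open>compose\<close> takes its
      proper value.\<close>
    moreover have "compose (carrier H) X (T i) (C x) = compose (carrier H) (U i) X (C x)"
      using X i by (simp add: intertwiners_def)
    ultimately show ?thesis
      using x bounded_operators_closed[OF Cb x] by (simp add: compose_eq)
  qed
  \<comment> \<open>The pointwise identity becomes an equality of functions: both sides are
    \<open>undefined\<close> off the carrier, and on it \<open>T i x\<close> stays in the carrier,
    so the inner \<open>compose\<close> can be evaluated.\<close>
  then have "compose (carrier H) (compose (carrier H) X C) (T i) =
      compose (carrier H) (U i) (compose (carrier H) X C)" if "i \<in> {1..n}" for i
    using that bounded_operators_closed[OF T]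
    by (auto simp: compose_def restrict_def fun_eq_iff)
  moreover have "compose (carrier H) X C \<in> bounded_operators H K"
    using bounded_operators_compose[OF _ _ Cb Xb] H.inner_product_space_axioms by simp
  ultimately show ?thesis
    by (simp add: intertwiners_def)
qed

lemma Hlat_vimage_unitary_asymptote:
  assumes H: "hilbert_space H" and T: "commuting_tuple n H T"
    and asym: "unitary_asymptote n H T K X U" and N: "N \<in> Hlat n K U"
  shows "X -` N \<inter> carrier H \<in> Hlat n H T"
proof -
  have pair: "unitary_intertwining_pair n H T K X U"
    using asym by (simp add: unitary_asymptote_def)
  then have K: "hilbert_space K" and X: "X \<in> intertwiners n H T K U"
    by (simp_all add: unitary_intertwining_pair_def)
  have "C h \<in> X -` N \<inter> carrier H"
    if C: "C \<in> commutant n H T" and h: "h \<in> X -` N \<inter> carrier H" for C h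
  proof -
    have "compose (carrier H) X C \<in> intertwiners n H T K U"
      using intertwiners_compose_commutant[OF H _ X C] T by (simp add: commuting_tuple_def)
    then have "unitary_intertwining_pair n H T K (compose (carrier H) X C) U"
      using pair by (simp add: unitary_intertwining_pair_def)
    \<comment> \<open>The universal property is tested on the pair with \<open>K' = K\<close> and
      \<open>U' = U\<close>, so the factor intertwines \<open>U\<close> with itself and belongs to
      its commutant.\<close>
    then have "\<exists>!Y. Y \<in> intertwiners n K U K U \<and>
        compose (carrier H) X C = compose (carrier H) Y X"
      using asym by (simp add: unitary_asymptote_def)
    then obtain Y where Y: "Y \<in> commutant n K U"
      and XC: "compose (carrier H) X C = compose (carrier H) Y X"
      by (auto simp: commutant_def)
    have "X (C h) = Y (X h)"
      using fun_cong[OF XC, of h] h by (simp add: compose_eq)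
    moreover have "Y (X h) \<in> N"
      using Y N h by (auto simp: Hlat_def)
    moreover have "C h \<in> carrier H"
      using C h by (auto simp: commutant_def intertwiners_def intro: bounded_operators_closed)
    ultimately show ?thesis
      by simp
  qed
  moreover have "closed_subspace H (X -` N \<inter> carrier H)"
    using closed_subspace_vimage[OF H K] X N by (simp add: intertwiners_def Hlat_def)
  ultimately show ?thesis
    by (auto simp: Hlat_def)
qed

text \<open>Linear operators fix the zero vector. Taking this subspace as \<open>N\<close> turns the
  preimage under \<open>X\<close> into its kernel.\<close>

lemma zero_in_Hlat:
  assumes "hilbert_space K"
  shows "{\<zero>\<^bsub>K\<^esub>} \<in> Hlat n K U"
proof -
  interpret K: hilbert_space K by fact
  show ?thesis
    using bounded_operators_zero[OF assms assms] K.closed_subspace_zero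
    by (auto simp: Hlat_def commutant_def intertwiners_def)
qed

theorem proposition27:
  fixes n :: nat
    and H :: "'h hilbert" and T :: "nat \<Rightarrow> 'h \<Rightarrow> 'h"
    and K :: "'k hilbert" and X :: "'h \<Rightarrow> 'k" and U :: "nat \<Rightarrow> 'k \<Rightarrow> 'k"
  assumes "hilbert_space H"
    and "separable_space (htopology H)"
    and "commuting_tuple n H T"
    and "unitary_asymptote n H T K X U"
    and "X \<noteq> (\<lambda>h\<in>carrier H. \<zero>\<^bsub>K\<^esub>)"
  shows "(\<forall>N\<in>Hlat n K U. X -` N \<inter> carrier H \<in> Hlat n H T) \<and>
    annihilating_subspace TYPE('k) n H T = X -` {\<zero>\<^bsub>K\<^esub>} \<inter> carrier H \<and>
    annihilating_subspace TYPE('k) n H T \<in> Hlat n H T"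
proof -
  have "hilbert_space K"
    using assms(4) by (simp add: unitary_asymptote_def unitary_intertwining_pair_def)
  then show ?thesis
    \<comment> \<open>The annihilating subspace is identified with the kernel of the given
      \<open>X\<close>, so its hyperinvariance is the case of the zero subspace.\<close>
    using Hlat_vimage_unitary_asymptote[OF assms(1,3,4)] zero_in_Hlat
      annihilating_subspace_eq[OF assms(4)] by auto
qed

end
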